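(* Let $G$ be a connected block-cactus graph (a graph in which every block is either a cycle or a complete graph), regarded as a graph of goods, and let $N=[n]$ be any finite set of $n\ge 1$ agents with nonnegative additive utility functions $u_1,\dots,u_n$ on $V(G)$. Then there exists a $\frac12$-mms-allocation, i.e., a $(G,n)$-partition $(A_1,\dots,A_n)$ of $V(G)$ into bundles such that $u_i(A_i)\ge \frac12\,\mathsf{mms}^{(n)}(G,u_i)$ for every $i\in[n]$.
   Context: A block of a graph is a maximal biconnected subgraph (a connected subgraph without a cut-vertex). Goods are the vertices of the graph $G$. Each agent $i$ has a utility function $u_i$ assigning a nonnegative real to each vertex, extended additively to sets: $u_i(X)=\sum_{v\in X}u_i(v)$, $u_i(\emptyset)=0$. A bundle is a set $X\subseteq V(G)$ inducing a connected subgraph of $G$ (the empty set is a bundle). A $(G,n)$-partition is a tuple $(P_1,\dots,P_n)$ of pairwise disjoint bundles with $\bigcup_j P_j=V(G)$; as an allocation, $P_i$ is given to agent $i$. The maximin share is $\mathsf{mms}^{(n)}(G,u)=\max_{(P_1,\dots,P_n)}\min_{j\in[n]}u(P_j)$, the maximum over all $(G,n)$-partitions. *)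

theory Defs
  imports Complex_Main "HOL-Library.Disjoint_Sets" "Graph_Theory.Graph_Theory"
begin

text \<open>
  Finite simple undirected graphs are the symmetric digraphs of the locale \<^locale>\<open>graph\<close>: an
  edge is a pair of opposite arcs.  Connectedness is \<^const>\<open>Digraph_Component.connected\<close>, written
  with its qualifier because of the topological notion of the same name; it excludes the graph
  without vertices.
\<close>

text \<open>A cut-vertex separates two other vertices of the same component.\<close>

definition cut_vertex :: "('a, 'b) pre_digraph \<Rightarrow> 'a \<Rightarrow> bool" where
  "cut_vertex H v \<longleftrightarrow> v \<in> verts H \<and>
     (\<exists>x \<in> verts H - {v}. \<exists>y \<in> verts H - {v}.
        x \<rightarrow>\<^sup>*\<^bsub>H\<^esub> y \<and> \<not> x \<rightarrow>\<^sup>*\<^bsub>pre_digraph.del_vert H v\<^esub> y)"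

text \<open>
  The condition \<^term>\<open>graph H\<close> makes sure that only undirected subgraphs compete in the
  maximality condition of a block: \<^const>\<open>subgraph\<close> alone would also admit subdigraphs that
  contain only one of two opposite arcs.
\<close>

definition biconnected :: "('a, 'b) pre_digraph \<Rightarrow> bool" where
  "biconnected H \<longleftrightarrow> graph H \<and> Digraph_Component.connected H \<and> (\<nexists>v. cut_vertex H v)"

definition block :: "('a, 'b) pre_digraph \<Rightarrow> ('a, 'b) pre_digraph \<Rightarrow> bool" where
  "block G H \<longleftrightarrow> pre_digraph.max_subgraph G biconnected H"

definition cycle_graph :: "('a, 'b) pre_digraph \<Rightarrow> bool" where
  "cycle_graph H \<longleftrightarrow> graph H \<and>
     (\<exists>vs. distinct vs \<and> length vs \<ge> 3 \<and> verts H = set vs \<and>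
        arcs_ends H = (\<Union>i < length vs.
          {(vs ! i, vs ! (Suc i mod length vs)), (vs ! (Suc i mod length vs), vs ! i)}))"

definition complete_graph :: "('a, 'b) pre_digraph \<Rightarrow> bool" where
  "complete_graph H \<longleftrightarrow> (\<exists>m. complete_digraph m H)"

definition block_cactus :: "('a, 'b) pre_digraph \<Rightarrow> bool" where
  "block_cactus G \<longleftrightarrow> graph G \<and> (\<forall>H. block G H \<longrightarrow> cycle_graph H \<or> complete_graph H)"

definition connected_bundle :: "('a, 'b) pre_digraph \<Rightarrow> 'a set \<Rightarrow> bool" where
  "connected_bundle G X \<longleftrightarrow> X \<subseteq> verts G \<and> (X = {} \<or> Digraph_Component.connected (G \<restriction> X))"

text \<open>Tuples indexed by \<open>[n]\<close> are functions on \<open>nat\<close>, relevant on \<open>{1..n}\<close> only.\<close>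

definition graph_partition :: "('a, 'b) pre_digraph \<Rightarrow> nat \<Rightarrow> (nat \<Rightarrow> 'a set) \<Rightarrow> bool" where
  "graph_partition G n P \<longleftrightarrow> (\<forall>j \<in> {1..n}. connected_bundle G (P j)) \<and>
     disjoint_family_on P {1..n} \<and> (\<Union>j \<in> {1..n}. P j) = verts G"

definition mms :: "nat \<Rightarrow> ('a, 'b) pre_digraph \<Rightarrow> ('a \<Rightarrow> real) \<Rightarrow> real" where
  "mms n G u = Max {Min ((\<lambda>j. sum u (P j)) ` {1..n}) | P. graph_partition G n P}"

text \<open>The maximum in \<^const>\<open>mms\<close> is over a finite nonempty set of values.\<close>

lemma finite_mms_values:
  assumes "graph G"
  shows "finite {Min ((\<lambda>j. sum u (P j)) ` {1..n}) | P. graph_partition G n P}"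
proof (rule finite_subset)
  have fin: "finite (verts G)"
    using assms by (simp add: graph_def digraph_def fin_digraph.finite_verts)
  show "{Min ((\<lambda>j. sum u (P j)) ` {1..n}) | P. graph_partition G n P}
      \<subseteq> Min ` Pow (sum u ` Pow (verts G))"
    by (fastforce simp: graph_partition_def connected_bundle_def)
  show "finite (Min ` Pow (sum u ` Pow (verts G)))"
    using fin by simp
qed

lemma mms_values_nonempty:
  assumes "graph G" "Digraph_Component.connected G" "n \<ge> 1"
  shows "{Min ((\<lambda>j. sum u (P j)) ` {1..n}) | P. graph_partition G n P} \<noteq> {}"
proof -
  have "wf_digraph G"
    using assms(1) by (simp add: graph_def digraph_def fin_digraph_def)
  then have "G \<restriction> verts G = G"
    by (simp add: induce_subgraph_def wf_digraph.wellformed cong: conj_cong)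
  then have "graph_partition G n (\<lambda>j. if j = 1 then verts G else {})"
    using assms by (auto simp: graph_partition_def connected_bundle_def disjoint_family_on_def)
  then show ?thesis by blast
qed

end

theory Submission
  imports Defs
begin

text \<open>
  Scale all utilities so that the maximin shares are 1; every agent then has a packing of the graph
  by as many disjoint connected sets of value at least 1 as there are agents.  The property of
  block-cactus graphs that matters is hereditary: every biconnected vertex set has a Hamiltonian
  path starting at any prescribed vertex.

  Let \<open>C\<close> be a smallest nonempty vertex set that some vertex \<open>t\<close> separates from the rest; then
  \<open>C \<union> {t}\<close> is biconnected.  If an agent values some \<open>b \<in> C\<close> at least \<open>1/2\<close>, she gets \<open>{b}\<close>, which
  destroys at most one set in the packing of any other agent.  Otherwise bags are cut off a
  Hamiltonian path of \<open>C \<union> {t}\<close> from the end opposite to \<open>t\<close>, each as soon as it is worth \<open>1/2\<close> to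
  somebody, until the rest \<open>D\<close> of \<open>C\<close> is worth less than \<open>1/2\<close> to every remaining agent.  Each bag is
  worth at most 1 to everybody.  Hence, if an agent has \<open>k\<close> packing sets inside \<open>C\<close> and \<open>m\<close> bags were
  cut, then \<open>k \<le> m\<close>, and if \<open>k = m\<close>, then \<open>D\<close> compensates for what the packing set through \<open>t\<close> loses
  in \<open>C\<close>.  So one can merge \<open>D\<close> into \<open>t\<close>, delete \<open>C\<close> and recurse.
\<close>

section \<open>Connectivity of vertex sets\<close>

text \<open>In contrast to \<^const>\<open>Digraph_Component.connected\<close>, the empty set is connected here.\<close>

definition connected_on :: "('a \<times> 'a) set \<Rightarrow> 'a set \<Rightarrow> bool" where
  "connected_on E S \<longleftrightarrow>
     (\<forall>A\<subseteq>S. A \<noteq> {} \<longrightarrow> (\<forall>x\<in>A. \<forall>y\<in>S. (x, y) \<in> E \<longrightarrow> y \<in> A) \<longrightarrow> A = S)"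

definition biconnected_on :: "('a \<times> 'a) set \<Rightarrow> 'a set \<Rightarrow> bool" where
  "biconnected_on E S \<longleftrightarrow> connected_on E S \<and> (\<forall>v\<in>S. connected_on E (S - {v}))"

text \<open>A Hamiltonian path of \<open>S\<close> with \<open>t\<close> at its head. Every prefix
  through \<open>t\<close> is again a path, so that cutting pieces off the far end leaves a
  remainder attached to \<open>t\<close>.\<close>

definition traceable_from :: "('a \<times> 'a) set \<Rightarrow> 'a set \<Rightarrow> 'a \<Rightarrow> bool" where
  "traceable_from E S t \<longleftrightarrow>
     (\<exists>xs. distinct (t # xs) \<and> set (t # xs) = S \<and> successively (\<lambda>x y. (x, y) \<in> E) (t # xs))"

text \<open>For symmetric \<open>E\<close>, the set \<open>C\<close> is a nonempty union of
  components of \<open>V - {t}\<close>. It need not be connected and may be all of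
  \<open>V - {t}\<close>, so any \<open>V\<close> with two vertices has a branch.\<close>

definition branch :: "('a \<times> 'a) set \<Rightarrow> 'a set \<Rightarrow> 'a \<Rightarrow> 'a set \<Rightarrow> bool" where
  "branch E V t C \<longleftrightarrow> t \<in> V \<and> C \<noteq> {} \<and> C \<subseteq> V - {t} \<and>
     (\<forall>x\<in>C. \<forall>y\<in>V. (x, y) \<in> E \<longrightarrow> y \<in> C \<or> y = t)"

lemma connected_onI:
  assumes "\<And>A. A \<subseteq> S \<Longrightarrow> A \<noteq> {} \<Longrightarrow> (\<And>x y. x \<in> A \<Longrightarrow> y \<in> S \<Longrightarrow> (x, y) \<in> E \<Longrightarrow> y \<in> A) \<Longrightarrow> S \<subseteq> A"
  shows "connected_on E S"
  unfolding connected_on_def by (meson assms subset_antisym)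

lemma connected_onD:
  assumes "connected_on E S" "A \<subseteq> S" "A \<noteq> {}"
    and "\<And>x y. x \<in> A \<Longrightarrow> y \<in> S \<Longrightarrow> (x, y) \<in> E \<Longrightarrow> y \<in> A"
  shows "A = S"
  using assms unfolding connected_on_def by blast

lemma connected_on_empty [simp]: "connected_on E {}"
  by (auto simp: connected_on_def)

lemma connected_on_singleton [simp]: "connected_on E {x}"
  by (auto simp: connected_on_def)

lemma connected_on_Un:
  assumes "connected_on E A" "connected_on E B" "A \<inter> B \<noteq> {}"
  shows "connected_on E (A \<union> B)"
proof (rule connected_onI)
  fix X assume X: "X \<subseteq> A \<union> B" "X \<noteq> {}"
    and cl: "\<And>x y. x \<in> X \<Longrightarrow> y \<in> A \<union> B \<Longrightarrow> (x, y) \<in> E \<Longrightarrow> y \<in> X"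
  have "A \<subseteq> X" if "X \<inter> A \<noteq> {}"
    using connected_onD[OF assms(1), of "X \<inter> A"] that cl by blast
  moreover have "B \<subseteq> X" if "X \<inter> B \<noteq> {}"
    using connected_onD[OF assms(2), of "X \<inter> B"] that cl by blast
  ultimately show "A \<union> B \<subseteq> X"
    using X assms(3) by blast
qed

lemma connected_on_edge:
  assumes "sym E" "(x, y) \<in> E"
  shows "connected_on E {x, y}"
  using assms by (auto simp: connected_on_def sym_def)

lemma connected_on_path:
  assumes "sym E" "successively (\<lambda>x y. (x, y) \<in> E) xs"
  shows "connected_on E (set xs)"
  using assms(2)
proof (induction xs rule: induct_list012)
  case (3 x y zs)
  then have "connected_on E ({x, y} \<union> set (y # zs))"
    using assms(1) by (intro connected_on_Un connected_on_edge) auto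
  then show ?case by (simp add: insert_commute)
qed auto

text \<open>A closed part of \<open>V - C\<close> yields a closed part of \<open>V\<close>: if it
  contains \<open>t\<close>, the vertices of \<open>C\<close> in \<open>V\<close> are added; if not,
  no edge joins it to \<open>C\<close>.\<close>

lemma connected_on_Diff_branch:
  assumes "sym E" "connected_on E V" "t \<in> V" "t \<notin> C"
    and br: "\<And>x y. x \<in> C \<Longrightarrow> y \<in> V \<Longrightarrow> (x, y) \<in> E \<Longrightarrow> y \<in> C \<or> y = t"
  shows "connected_on E (V - C)"
proof (rule connected_onI)
  fix A assume A: "A \<subseteq> V - C" "A \<noteq> {}"
    and cl: "\<And>x y. x \<in> A \<Longrightarrow> y \<in> V - C \<Longrightarrow> (x, y) \<in> E \<Longrightarrow> y \<in> A"
  show "V - C \<subseteq> A"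
  proof (cases "t \<in> A")
    case True
    have "A \<union> (C \<inter> V) = V"
      using A cl br True by (intro connected_onD[OF assms(2)]) blast+
    then show ?thesis by blast
  next
    case False
    have "A = V"
    proof (rule connected_onD[OF assms(2)])
      fix x y assume xy: "x \<in> A" "y \<in> V" "(x, y) \<in> E"
      then have "(y, x) \<in> E" using assms(1) by (auto dest: symD)
      then show "y \<in> A" using br[of y x] xy A False cl by blast
    qed (use A in auto)
    then show ?thesis using False assms(3) by blast
  qed
qed

text \<open>A branch of least cardinality works: if deleting a vertex disconnected
  \<open>insert t C\<close>, some piece would be attached through that vertex only and so be a
  smaller branch.\<close>

lemma branch_biconnected_exists:
  assumes sym: "sym E" and fin: "finite V" and con: "connected_on E V"
    and two: "r \<in> V" "V \<noteq> {r}"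
  obtains t C where "branch E V t C" "biconnected_on E (insert t C)"
proof -
  have "branch E V r (V - {r})"
    using two by (auto simp: branch_def)
  then have ex: "(\<lambda>p. branch E V (fst p) (snd p)) (r, V - {r})" by simp
  obtain p where "branch E V (fst p) (snd p)"
    and "\<And>q. branch E V (fst q) (snd q) \<Longrightarrow> card (snd p) \<le> card (snd q)"
    using ex_has_least_nat[of "\<lambda>p. branch E V (fst p) (snd p)", OF ex, of "\<lambda>p. card (snd p)"]
    by blast
  then obtain t C where br: "branch E V t C"
    and least: "\<And>t' C'. branch E V t' C' \<Longrightarrow> card C \<le> card C'"
    by (metis fst_conv snd_conv)
  have t: "t \<in> V" "t \<notin> C" "C \<subseteq> V" "C \<noteq> {}"
    and edge: "\<And>x y. x \<in> C \<Longrightarrow> y \<in> V \<Longrightarrow> (x, y) \<in> E \<Longrightarrow> y \<in> C \<or> y = t"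
    using br by (auto simp: branch_def)
  have finC: "finite C" using fin t(3) by (rule finite_subset[rotated])
  have min: False if "A \<subset> C" "A \<noteq> {}" "c \<in> V - A"
    and cl: "\<And>x y. x \<in> A \<Longrightarrow> y \<in> V \<Longrightarrow> (x, y) \<in> E \<Longrightarrow> y \<in> A \<or> y = c" for A c
  proof -
    have "branch E V c A" using that t by (auto simp: branch_def)
    then show False using least psubset_card_mono[OF finC that(1)] by fastforce
  qed
  \<comment> \<open>The vertices outside \<open>insert t C\<close> also reach the rest only through
    \<open>t\<close>, so removing them preserves connectedness.\<close>
  have "connected_on E (V - (V - insert t C))"
  proof (rule connected_on_Diff_branch[OF sym con t(1)])
    fix x y assume "x \<in> V - insert t C" "y \<in> V" "(x, y) \<in> E"
    then show "y \<in> V - insert t C \<or> y = t"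
      using edge[of y x] symD[OF sym] by blast
  qed simp
  then have whole: "connected_on E (insert t C)"
    using t by (simp add: double_diff)
  have rest: "connected_on E C"
  proof (rule connected_onI)
    fix A assume A: "A \<subseteq> C" "A \<noteq> {}" "\<And>x y. x \<in> A \<Longrightarrow> y \<in> C \<Longrightarrow> (x, y) \<in> E \<Longrightarrow> y \<in> A"
    then show "C \<subseteq> A" using min[of A t] edge t by blast
  qed
  have del: "connected_on E (insert t C - {c})" if c: "c \<in> C" for c
  proof (rule connected_onI)
    fix A assume A: "A \<subseteq> insert t C - {c}" "A \<noteq> {}"
      "\<And>x y. x \<in> A \<Longrightarrow> y \<in> insert t C - {c} \<Longrightarrow> (x, y) \<in> E \<Longrightarrow> y \<in> A"
    \<comment> \<open>A closed piece avoiding \<open>t\<close> can be left only through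
      \<open>c\<close>, which contradicts the minimality of \<open>C\<close>.\<close>
    have no: False if "B \<subseteq> C - {c}" "B \<noteq> {}"
      "\<And>x y. x \<in> B \<Longrightarrow> y \<in> insert t C - {c} \<Longrightarrow> (x, y) \<in> E \<Longrightarrow> y \<in> B" for B
    proof (rule min[of B c])
      show "B \<subset> C" "B \<noteq> {}" "c \<in> V - B" using that c t by auto
      show "y \<in> B \<or> y = c" if "x \<in> B" "y \<in> V" "(x, y) \<in> E" for x y
        using that edge[of x y] \<open>B \<subseteq> C - {c}\<close> \<open>\<And>x y. x \<in> B \<Longrightarrow> y \<in> insert t C - {c} \<Longrightarrow> (x, y) \<in> E \<Longrightarrow> y \<in> B\<close>
        by blast
    qed
    have "t \<in> A" using no[of A] A by blast
    \<comment> \<open>By symmetry the complement of a closed piece is closed, and this one avoids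
      \<open>t\<close>.\<close>
    have "insert t C - {c} - A = {}"
    proof (rule ccontr)
      assume ne: "insert t C - {c} - A \<noteq> {}"
      show False
      proof (rule no[OF _ ne])
        show "insert t C - {c} - A \<subseteq> C - {c}" using \<open>t \<in> A\<close> by blast
        show "y \<in> insert t C - {c} - A"
          if "x \<in> insert t C - {c} - A" "y \<in> insert t C - {c}" "(x, y) \<in> E" for x y
          using that A(3)[of y x] symD[OF sym] by blast
      qed
    qed
    then show "insert t C - {c} \<subseteq> A" by blast
  qed
  have "biconnected_on E (insert t C)"
    using whole rest del t(2) by (auto simp: biconnected_on_def)
  with br show thesis by (rule that)
qed

section \<open>Packings and bag filling\<close>

text \<open>The sets need not cover \<open>V\<close>, which lets packings survive the deletion of
  vertices. A set of sets can replace an indexed family because a value of at least 1 excludes the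
  empty set.\<close>

definition packing :: "('a \<times> 'a) set \<Rightarrow> 'a set \<Rightarrow> ('a \<Rightarrow> real) \<Rightarrow> nat \<Rightarrow> bool" where
  "packing E V w k \<longleftrightarrow>
     (\<exists>F. k \<le> card F \<and> disjoint F \<and> (\<forall>Q\<in>F. Q \<subseteq> V \<and> connected_on E Q \<and> 1 \<le> sum w Q))"

lemma packing_antimono: "packing E V w k \<Longrightarrow> l \<le> k \<Longrightarrow> packing E V w l"
  unfolding packing_def by (meson order_trans)

lemma packing_remove_vertex:
  assumes "finite V" "packing E V w (Suc k)"
  shows "packing E (V - {b}) w k"
proof -
  obtain F where F: "Suc k \<le> card F" "disjoint F"
    "\<And>Q. Q \<in> F \<Longrightarrow> Q \<subseteq> V \<and> connected_on E Q \<and> 1 \<le> sum w Q"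
    using assms(2) by (auto simp: packing_def)
  have finF: "finite F" using F(1) card.infinite by fastforce
  have "Q = R" if "Q \<in> F" "R \<in> F" "b \<in> Q" "b \<in> R" for Q R
    using F(2) that by (auto simp: disjoint_def)
  \<comment> \<open>\<open>B\<close> is the only possible member through \<open>b\<close>, and
    arbitrary if there is none.\<close>
  then obtain B where B: "\<And>Q. Q \<in> F \<Longrightarrow> b \<in> Q \<Longrightarrow> Q = B"
    by metis
  have "card (F - {B}) \<ge> k" using F(1) finF by (auto simp: card_Diff_singleton_if)
  moreover have "disjoint (F - {B})" using F(2) by (auto simp: disjoint_def)
  ultimately show ?thesis
    unfolding packing_def using F(3) B by (intro exI[of _ "F - {B}"]) auto
qed

text \<open>In the application, \<open>m\<close> bags have been cut from \<open>C\<close> and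
  \<open>D\<close> is the uncut rest. The packing splits into the sets inside \<open>C\<close> (at
  most \<open>m\<close>, by value), those avoiding \<open>C\<close> and \<open>t\<close>, and at
  most one through \<open>t\<close>. The last one must be kept only if exactly \<open>m\<close> sets
  lie inside \<open>C\<close>; then it owns at most the value of \<open>D\<close> in
  \<open>C\<close>, which the new weight of \<open>t\<close> pays back.\<close>

lemma packing_remove_branch:
  assumes sym: "sym E" and fin: "finite V" and nonneg: "\<And>v. v \<in> V \<Longrightarrow> 0 \<le> w v"
    and br: "branch E V t C" and pack: "packing E V w k"
    and D: "D \<subseteq> C" "sum w D < 1 / 2" "sum w (C - D) \<le> real m"
  shows "packing E (V - C) (w(t := w t + sum w D)) (k - m)"
proof -
  let ?w = "w(t := w t + sum w D)"
  have t: "t \<in> V" "t \<notin> C" "C \<subseteq> V"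
    and edge: "\<And>x y. x \<in> C \<Longrightarrow> y \<in> V \<Longrightarrow> (x, y) \<in> E \<Longrightarrow> y \<in> C \<or> y = t"
    using br by (auto simp: branch_def)
  have finC: "finite C" using fin t(3) by (rule finite_subset[rotated])
  obtain F where F: "k \<le> card F" "disjoint F"
    and FQ: "\<And>Q. Q \<in> F \<Longrightarrow> Q \<subseteq> V \<and> connected_on E Q \<and> 1 \<le> sum w Q"
    using pack by (auto simp: packing_def)
  have finF: "finite F" using FQ fin by (meson PowI finite_Pow_iff finite_subset subsetI)
  define In where "In = {Q \<in> F. Q \<subseteq> C}"
  define Out where "Out = {Q \<in> F. t \<notin> Q \<and> \<not> Q \<subseteq> C}"
  define At where "At = {Q \<in> F. t \<in> Q}"
  have "F = In \<union> Out \<union> At" "In \<inter> Out = {}" "(In \<union> Out) \<inter> At = {}"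
    using t(2) by (auto simp: In_def Out_def At_def)
  then have cardF: "card F = card In + card Out + card At"
    using finF by (metis card_Un_disjoint finite_Un)
  have Out: "Q \<subseteq> V - C" "sum ?w Q = sum w Q" if "Q \<in> Out" for Q
  proof -
    have Q: "Q \<in> F" "t \<notin> Q" "\<not> Q \<subseteq> C" using that by (auto simp: Out_def)
    \<comment> \<open>Edges leave \<open>C\<close> only towards \<open>t\<close>, so a connected set
      without \<open>t\<close> that meets \<open>C\<close> lies inside \<open>C\<close>.\<close>
    have "Q \<inter> C = Q" if "Q \<inter> C \<noteq> {}"
      using that FQ[OF Q(1)] Q(2) edge by (intro connected_onD[of E Q]) blast+
    then show "Q \<subseteq> V - C" using Q FQ by blast
    show "sum ?w Q = sum w Q" using Q(2) by (intro sum.cong) auto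
  qed
  have disjOut: "disjoint Out" using F(2) by (auto simp: disjoint_def Out_def)
  have packOut: ?thesis if "k - m \<le> card Out"
    unfolding packing_def using that disjOut Out FQ
    by (intro exI[of _ Out]) (auto simp: Out_def)
  have "real (card In) = (\<Sum>Q\<in>In. 1)" by simp
  also have "\<dots> \<le> (\<Sum>Q\<in>In. sum w Q)" using FQ by (intro sum_mono) (auto simp: In_def)
  also have "\<dots> = sum w (\<Union>In)"
    using F(2) finite_subset[OF _ finC]
    by (subst sum.Union_disjoint) (auto simp: In_def disjoint_def)
  finally have cardIn: "real (card In) \<le> sum w (\<Union>In)" .
  have sumC: "sum w C = sum w D + sum w (C - D)"
    using D(1) finC by (metis add.commute sum.subset_diff)
  show ?thesis
  proof (cases "At = {}")
    case True
    have "sum w (\<Union>In) \<le> sum w C"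
      using t nonneg finC by (intro sum_mono2) (auto simp: In_def)
    \<comment> \<open>The value of \<open>C\<close> is below \<open>m + 1/2\<close>, and
      \<open>card In\<close> is an integer.\<close>
    then have "card In \<le> m" using cardIn sumC D by linarith
    then show ?thesis using packOut cardF True F(1) by simp
  next
    case False
    then obtain Q where "Q \<in> At" by blast
    then have At: "At = {Q}" and Q: "Q \<in> F" "t \<in> Q"
      using F(2) by (auto simp: At_def disjoint_def)
    have "sum w (\<Union>In) + sum w (Q \<inter> C) = sum w (\<Union>In \<union> (Q \<inter> C))"
    proof (rule sum.union_disjoint[symmetric])
      show "finite (\<Union>In)" by (rule finite_subset[OF _ finC]) (auto simp: In_def)
      show "\<Union>In \<inter> (Q \<inter> C) = {}"
        using F(2) Q t(2) by (fastforce simp: In_def disjoint_def)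
    qed (use finC in auto)
    also have "\<dots> \<le> sum w C"
      using t nonneg finC by (intro sum_mono2) (auto simp: In_def)
    finally have le: "real (card In) + sum w (Q \<inter> C) \<le> sum w D + sum w (C - D)"
      using cardIn sumC by linarith
    have ge0: "0 \<le> sum w (Q \<inter> C)" using t nonneg by (intro sum_nonneg) auto
    show ?thesis
    proof (cases "card In < m")
      case True
      \<comment> \<open>With fewer than \<open>m\<close> sets inside \<open>C\<close>, the set
        through \<open>t\<close> can be given up too.\<close>
      then show ?thesis using packOut cardF At F(1) by simp
    next
      case False
      moreover have "card In \<le> m" using le ge0 D by linarith
      ultimately have m: "card In = m" by simp
      then have DQ: "sum w (Q \<inter> C) \<le> sum w D" using le D(3) by simp
      have finQ: "finite Q" using FQ[OF Q(1)] fin finite_subset by blast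
      have "sum ?w (Q - C) = ?w t + sum ?w (Q - C - {t})"
        using finQ Q t by (intro sum.remove) auto
      also have "sum ?w (Q - C - {t}) = sum w (Q - C - {t})"
        by (intro sum.cong) auto
      also have "?w t + \<dots> = sum w D + sum w (Q - C)"
        using finQ Q t by (subst (3) sum.remove[of _ t]) auto
      also have "\<dots> \<ge> sum w Q"
        using DQ sum.Int_Diff[OF finQ, of w C] by simp
      finally have "1 \<le> sum ?w (Q - C)" using FQ[OF Q(1)] by linarith
      moreover have "connected_on E (Q - C)"
        using FQ[OF Q(1)] Q t edge by (intro connected_on_Diff_branch[OF sym]) auto
      moreover have "disjoint (insert (Q - C) Out)"
        using F(2) Q by (fastforce simp: disjoint_def Out_def)
      moreover have "Q - C \<notin> Out" using Q t by (auto simp: Out_def)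
      moreover have "finite Out" using finF by (simp add: Out_def)
      ultimately show ?thesis
        unfolding packing_def using Out FQ Q F(1) cardF At m
        by (intro exI[of _ "insert (Q - C) Out"]) (auto simp: Out_def)
    qed
  qed
qed

text \<open>Bags are cut from the end of \<open>ys\<close>; \<open>p\<close> is the length of the
  uncut prefix and \<open>M\<close> the set of agents served, one bag each. A bag is a shortest
  suffix worth 1/2 to somebody: a vertex below 1/2 plus a suffix below 1/2. Nobody values it above
  1, which gives the bound by \<open>card M\<close>.\<close>

lemma bag_filling:
  fixes u :: "'i \<Rightarrow> 'a \<Rightarrow> real"
  assumes sym: "sym E"
  shows "distinct ys \<Longrightarrow> successively (\<lambda>x y. (x, y) \<in> E) ys \<Longrightarrow> finite N \<Longrightarrow>
    (\<And>i b. i \<in> N \<Longrightarrow> b \<in> set ys \<Longrightarrow> 0 \<le> u i b \<and> u i b < 1 / 2) \<Longrightarrow>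
    \<exists>p M A. M \<subseteq> N \<and> disjoint_family_on A M \<and>
      (\<forall>i\<in>M. A i \<subseteq> set (drop p ys) \<and> connected_on E (A i) \<and> 1 / 2 \<le> sum (u i) (A i)) \<and>
      (\<forall>i\<in>N - M. sum (u i) (set (take p ys)) < 1 / 2 \<and>
        sum (u i) (set (drop p ys)) \<le> real (card M))"
proof (induction "length ys" arbitrary: ys N rule: less_induct)
  case less
  show ?case
  proof (cases "\<forall>i\<in>N. sum (u i) (set ys) < 1 / 2")
    case True
    then show ?thesis
      by (intro exI[of _ "length ys"] exI[of _ "{}"]) (auto simp: disjoint_family_on_def)
  next
    case False
    define P where "P p \<longleftrightarrow> (\<exists>i\<in>N. 1 / 2 \<le> sum (u i) (set (drop p ys)))" for p
    have "P 0" using False by (auto simp: P_def not_less)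
    have bound: "p < length ys" if "P p" for p
      using that by (force simp: P_def intro: ccontr)
    \<comment> \<open>The greatest starting position gives the shortest suffix; it exists since the
      empty suffix is worth 0.\<close>
    define p where "p = (GREATEST p. P p)"
    have Pp: "P p" and notP: "\<not> P (Suc p)"
      unfolding p_def using \<open>P 0\<close> bound
      by (metis GreatestI_nat less_imp_le, metis Greatest_le_nat Suc_n_not_le_n less_imp_le)
    have plt: "p < length ys" using bound Pp by simp
    obtain i where i: "i \<in> N" "1 / 2 \<le> sum (u i) (set (drop p ys))"
      using Pp by (auto simp: P_def)
    have dr: "drop p ys = ys ! p # drop (Suc p) ys" using plt by (simp add: Cons_nth_drop_Suc)
    have small: "sum (u j) (set (drop p ys)) \<le> 1" if "j \<in> N" for j
    proof -
      have "distinct (ys ! p # drop (Suc p) ys)" using less.prems(1) dr by (metis distinct_drop)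
      then have "sum (u j) (set (drop p ys)) = u j (ys ! p) + sum (u j) (set (drop (Suc p) ys))"
        unfolding dr by simp
      moreover have "u j (ys ! p) < 1 / 2" using less.prems(4) that plt by simp
      moreover have "sum (u j) (set (drop (Suc p) ys)) < 1 / 2"
        using notP that by (auto simp: P_def not_le)
      ultimately show ?thesis by linarith
    qed
    have split: "ys = take p ys @ drop p ys" by simp
    have succ: "successively (\<lambda>x y. (x, y) \<in> E) (take p ys)"
      "successively (\<lambda>x y. (x, y) \<in> E) (drop p ys)"
      using less.prems(2) split by (metis successively_append_iff)+
    \<comment> \<open>The suffix goes to \<open>i\<close>, and the induction hypothesis handles the
      prefix with the other agents.\<close>
    have "\<exists>q M A. M \<subseteq> N - {i} \<and> disjoint_family_on A M \<and>
      (\<forall>i\<in>M. A i \<subseteq> set (drop q (take p ys)) \<and> connected_on E (A i) \<and> 1 / 2 \<le> sum (u i) (A i)) \<and>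
      (\<forall>j\<in>N - {i} - M. sum (u j) (set (take q (take p ys))) < 1 / 2 \<and>
        sum (u j) (set (drop q (take p ys))) \<le> real (card M))"
      using less.prems plt succ(1)
      by (intro less.hyps) (auto dest: in_set_takeD)
    then obtain q M A where M: "M \<subseteq> N - {i}" "disjoint_family_on A M"
      "\<And>i. i \<in> M \<Longrightarrow> A i \<subseteq> set (drop q (take p ys)) \<and> connected_on E (A i) \<and> 1 / 2 \<le> sum (u i) (A i)"
      "\<And>j. j \<in> N - {i} - M \<Longrightarrow> sum (u j) (set (take q (take p ys))) < 1 / 2 \<and>
        sum (u j) (set (drop q (take p ys))) \<le> real (card M)"
      by blast
    define r where "r = min q p"
    have tk: "take q (take p ys) = take r ys" by (simp add: r_def)
    have dq: "drop r ys = drop q (take p ys) @ drop p ys"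
    proof -
      have "drop r ys = drop r (take p ys @ drop p ys)" by simp
      also have "\<dots> = drop r (take p ys) @ drop p ys"
        unfolding drop_append using plt by (simp add: r_def)
      also have "drop r (take p ys) = drop q (take p ys)"
        using plt by (cases "q \<le> p") (auto simp: r_def)
      finally show ?thesis .
    qed
    have disj: "set (take p ys) \<inter> set (drop p ys) = {}"
      using less.prems(1) by (simp add: set_take_disj_set_drop_if_distinct)
    then have disj': "set (drop q (take p ys)) \<inter> set (drop p ys) = {}"
      by (meson disjoint_iff in_set_dropD)
    define A' where "A' = A(i := set (drop p ys))"
    have finM: "finite M" using M(1) less.prems(3) by (meson finite_Diff finite_subset)
    show ?thesis
    proof (intro exI[of _ r] exI[of _ "insert i M"] exI[of _ A'] conjI)
      show "insert i M \<subseteq> N" using M(1) i by blast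
      show "disjoint_family_on A' (insert i M)"
        using M disj' unfolding disjoint_family_on_def A'_def by (auto; blast)
      show "\<forall>j\<in>insert i M. A' j \<subseteq> set (drop r ys) \<and> connected_on E (A' j) \<and> 1 / 2 \<le> sum (u j) (A' j)"
        using M i connected_on_path[OF sym succ(2)] unfolding A'_def dq by auto
      show "\<forall>j\<in>N - insert i M. sum (u j) (set (take r ys)) < 1 / 2 \<and>
        sum (u j) (set (drop r ys)) \<le> real (card (insert i M))"
      proof
        fix j assume j: "j \<in> N - insert i M"
        have "sum (u j) (set (drop r ys)) =
            sum (u j) (set (drop q (take p ys))) + sum (u j) (set (drop p ys))"
          unfolding dq using disj' by (simp add: sum.union_disjoint)
        then show "sum (u j) (set (take r ys)) < 1 / 2 \<and>
            sum (u j) (set (drop r ys)) \<le> real (card (insert i M))"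
          using M(4)[of j] M(1) small[of j] j finM unfolding tk by (subst card_insert_disjoint) auto
      qed
    qed
  qed
qed

text \<open>Sets \<open>A i\<close> that need not cover \<open>V\<close> suffice here; leftovers are
  distributed later. The induction generalises over \<open>u\<close> because merging
  \<open>D\<close> into \<open>t\<close> changes the utilities, and traceability is assumed for all
  biconnected subsets so that it passes to smaller \<open>V\<close>.\<close>

lemma half_allocation_exists:
  fixes u :: "'i \<Rightarrow> 'a \<Rightarrow> real"
  assumes sym: "sym E"
  shows "finite V \<Longrightarrow> connected_on E V \<Longrightarrow>
    (\<And>S t. S \<subseteq> V \<Longrightarrow> biconnected_on E S \<Longrightarrow> t \<in> S \<Longrightarrow> traceable_from E S t) \<Longrightarrow>
    finite N \<Longrightarrow> (\<And>i v. i \<in> N \<Longrightarrow> v \<in> V \<Longrightarrow> 0 \<le> u i v) \<Longrightarrow>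
    (\<And>i. i \<in> N \<Longrightarrow> packing E V (u i) (card N)) \<Longrightarrow>
    \<exists>A. disjoint_family_on A N \<and>
      (\<forall>i\<in>N. A i \<subseteq> V \<and> connected_on E (A i) \<and> 1 / 2 \<le> sum (u i) (A i))"
proof (induction "card V" arbitrary: V N u rule: less_induct)
  case less
  note fin = less.prems(1) and con = less.prems(2) and trace = less.prems(3)
    and finN = less.prems(4) and nonneg = less.prems(5) and pack = less.prems(6)
  show ?case
  proof (cases "N = {}")
    case True
    then show ?thesis by (auto simp: disjoint_family_on_def)
  next
    case False
    then obtain i\<^sub>0 where i0: "i\<^sub>0 \<in> N" by blast
    have "card N > 0" using False finN by (simp add: card_gt_0_iff)
    have part: "\<exists>F. card N \<le> card F \<and> F \<noteq> {} \<and> (\<forall>Q\<in>F. Q \<subseteq> V \<and> Q \<noteq> {} \<and> 1 \<le> sum (u i) Q)"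
      if i: "i \<in> N" for i
    proof -
      obtain F where F: "card N \<le> card F" "\<forall>Q\<in>F. Q \<subseteq> V \<and> 1 \<le> sum (u i) Q"
        using pack[OF i] by (auto simp: packing_def)
      moreover have "F \<noteq> {}" using F(1) \<open>card N > 0\<close> by auto
      moreover have "Q \<noteq> {}" if "Q \<in> F" for Q using F(2) that by fastforce
      ultimately show ?thesis by blast
    qed
    obtain r where r: "r \<in> V" using part[OF i0] by blast
    show ?thesis
    proof (cases "V = {r}")
      case True
      obtain F where F: "card N \<le> card F" "F \<noteq> {}" "\<forall>Q\<in>F. Q \<subseteq> V \<and> Q \<noteq> {} \<and> 1 \<le> sum (u i\<^sub>0) Q"
        using part[OF i0] by blast
      \<comment> \<open>On a single vertex a packing has just one member, so only one agent is
        present.\<close>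
      have "Q = {r}" if "Q \<in> F" for Q
        using F(3) that True by (metis subset_singletonD)
      then have "F = {{r}}" using F(2) by auto
      then have "card N = 1" "1 \<le> sum (u i\<^sub>0) {r}" using F \<open>card N > 0\<close> by auto
      then have "N = {i\<^sub>0}" using i0 by (metis card_1_singletonE singletonD)
      then show ?thesis using \<open>1 \<le> sum (u i\<^sub>0) {r}\<close> True
        by (intro exI[of _ "\<lambda>_. V"]) (auto simp: disjoint_family_on_def)
    next
      case False
      obtain t C where br: "branch E V t C" and bi: "biconnected_on E (insert t C)"
        using branch_biconnected_exists[OF sym fin con r False] by blast
      have t: "t \<in> V" "t \<notin> C" "C \<subseteq> V" "C \<noteq> {}"
        and edge: "\<And>x y. x \<in> C \<Longrightarrow> y \<in> V \<Longrightarrow> (x, y) \<in> E \<Longrightarrow> y \<in> C \<or> y = t"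
        using br by (auto simp: branch_def)
      have finC: "finite C" using fin t(3) by (rule finite_subset[rotated])
      have conVC: "connected_on E (V - C)"
        using t edge by (intro connected_on_Diff_branch[OF sym con]) auto
      show ?thesis
      proof (cases "\<exists>i\<in>N. \<exists>b\<in>C. 1 / 2 \<le> u i b")
        case True
        then obtain i b where i: "i \<in> N" and b: "b \<in> C" "1 / 2 \<le> u i b" by blast
        \<comment> \<open>Biconnectedness keeps the branch connected without \<open>b\<close>, and
          the two pieces meet in \<open>t\<close>.\<close>
        have "connected_on E ((insert t C - {b}) \<union> (V - C))"
          using bi b conVC t by (intro connected_on_Un) (auto simp: biconnected_on_def)
        moreover have "(insert t C - {b}) \<union> (V - C) = V - {b}" using t b by auto
        ultimately have conVb: "connected_on E (V - {b})" by simp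
        have cardN: "card N = Suc (card (N - {i}))" by (rule card.remove[OF finN i])
        have "\<exists>A. disjoint_family_on A (N - {i}) \<and> (\<forall>j\<in>N - {i}. A j \<subseteq> V - {b} \<and>
            connected_on E (A j) \<and> 1 / 2 \<le> sum (u j) (A j))"
        proof (rule less.hyps)
          show "card (V - {b}) < card V" using b t fin by (intro card_Diff1_less) auto
          show "packing E (V - {b}) (u j) (card (N - {i}))" if "j \<in> N - {i}" for j
            using pack[of j] that unfolding cardN by (intro packing_remove_vertex[OF fin]) auto
          show "traceable_from E S t" if "S \<subseteq> V - {b}" "biconnected_on E S" "t \<in> S" for S t
            using that by (intro trace) auto
        qed (use fin conVb finN nonneg in auto)
        then obtain A where A: "disjoint_family_on A (N - {i})" "\<And>j. j \<in> N - {i} \<Longrightarrow>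
            A j \<subseteq> V - {b} \<and> connected_on E (A j) \<and> 1 / 2 \<le> sum (u j) (A j)" by blast
        define B where "B = A(i := {b})"
        have "disjoint_family_on B N"
          using A unfolding disjoint_family_on_def B_def by (auto; blast)
        moreover have "\<forall>j\<in>N. B j \<subseteq> V \<and> connected_on E (B j) \<and> 1 / 2 \<le> sum (u j) (B j)"
          using A(2) b t by (auto simp: B_def)
        ultimately show ?thesis by blast
      next
        case False
        have "traceable_from E (insert t C) t" using trace[of "insert t C" t] t bi by simp
        then obtain ys where ys: "distinct (t # ys)" "insert t (set ys) = insert t C"
          "successively (\<lambda>x y. (x, y) \<in> E) (t # ys)"
          by (auto simp: traceable_from_def)
        have setys: "set ys = C" using ys(1,2) t(2) by auto
        have sys: "successively (\<lambda>x y. (x, y) \<in> E) ys"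
          using ys(3) by (cases ys) auto
        have dys: "distinct ys" using ys(1) by simp
        have small: "0 \<le> u i b \<and> u i b < 1 / 2" if "i \<in> N" "b \<in> set ys" for i b
          using that nonneg False t(3) setys by (auto simp: not_le)
        obtain p M A where M: "M \<subseteq> N" "disjoint_family_on A M"
          and A: "\<And>i. i \<in> M \<Longrightarrow>
            A i \<subseteq> set (drop p ys) \<and> connected_on E (A i) \<and> 1 / 2 \<le> sum (u i) (A i)"
          and rest: "\<And>i. i \<in> N - M \<Longrightarrow> sum (u i) (set (take p ys)) < 1 / 2 \<and>
            sum (u i) (set (drop p ys)) \<le> real (card M)"
          using bag_filling[where u = u, OF sym dys sys finN small] by metis
        define D where "D = set (take p ys)"
        have disj: "D \<inter> set (drop p ys) = {}"
          using ys(1) by (simp add: D_def set_take_disj_set_drop_if_distinct)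
        have un: "D \<union> set (drop p ys) = C"
          unfolding D_def set_append[symmetric] by (simp add: setys)
        have CD: "C - D = set (drop p ys)" and DC: "D \<subseteq> C" using disj un by blast+
        \<comment> \<open>\<open>t\<close> stands for \<open>insert t D\<close> in the recursive
          instance.\<close>
        define w where "w i = (u i)(t := u i t + sum (u i) D)" for i
        have conD: "connected_on E (insert t D)"
        proof -
          have "successively (\<lambda>x y. (x, y) \<in> E) (take (Suc p) (t # ys))"
            using ys(3) by (metis append_take_drop_id successively_append_iff)
          then show ?thesis using connected_on_path[OF sym] unfolding D_def by fastforce
        qed
        have "\<exists>B. disjoint_family_on B (N - M) \<and> (\<forall>i\<in>N - M. B i \<subseteq> V - C \<and>
            connected_on E (B i) \<and> 1 / 2 \<le> sum (w i) (B i))"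
        proof (rule less.hyps)
          show "card (V - C) < card V" using t fin by (intro psubset_card_mono) auto
          show "0 \<le> w i v" if "i \<in> N - M" "v \<in> V - C" for i v
            using that nonneg[of i] DC t unfolding w_def by (auto intro!: add_nonneg_nonneg sum_nonneg)
          show "packing E (V - C) (w i) (card (N - M))" if i: "i \<in> N - M" for i
            unfolding w_def card_Diff_subset[OF finite_subset[OF M(1) finN] M(1)]
            using i rest[OF i] nonneg pack DC CD
            by (intro packing_remove_branch[OF sym fin _ br]) (auto simp: D_def)
          show "traceable_from E S t" if "S \<subseteq> V - C" "biconnected_on E S" "t \<in> S" for S t
            using that by (intro trace) auto
        qed (use fin conVC finN in auto)
        then obtain B where B: "disjoint_family_on B (N - M)" "\<And>i. i \<in> N - M \<Longrightarrow>
            B i \<subseteq> V - C \<and> connected_on E (B i) \<and> 1 / 2 \<le> sum (w i) (B i)" by blast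
        \<comment> \<open>The merging is undone: whoever receives \<open>t\<close> also receives
          \<open>D\<close>. The union with \<open>insert t D\<close> makes both connected pieces
          share \<open>t\<close>. If nobody receives \<open>t\<close>, then \<open>D\<close> stays
          unassigned.\<close>
        define R where "R i = (if i \<in> M then A i else if t \<in> B i then B i \<union> insert t D else B i)" for i
        have "disjoint_family_on R N"
          unfolding disjoint_family_on_def
        proof (intro ballI impI)
          fix i j assume ij: "i \<in> N" "j \<in> N" "i \<noteq> j"
          have AM: "A k \<subseteq> C - D" if "k \<in> M" for k using A[OF that] CD by simp
          have BM: "B k \<subseteq> V - C" if "k \<in> N - M" for k using B(2)[OF that] by simp
          show "R i \<inter> R j = {}"
          proof (cases "i \<in> M"; cases "j \<in> M")
            assume "i \<in> M" "j \<in> M"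
            then show ?thesis using M(2) ij by (auto simp: R_def disjoint_family_on_def)
          next
            assume "i \<in> M" "j \<notin> M"
            then show ?thesis using AM[of i] BM[of j] ij DC t by (auto simp: R_def)
          next
            assume "i \<notin> M" "j \<in> M"
            then show ?thesis using AM[of j] BM[of i] ij DC t by (auto simp: R_def)
          next
            assume "i \<notin> M" "j \<notin> M"
            moreover from this have "B i \<inter> B j = {}"
              using B(1) ij by (auto simp: disjoint_family_on_def)
            ultimately show ?thesis using BM[of i] BM[of j] ij DC t by (auto simp: R_def)
          qed
        qed
        moreover have "R i \<subseteq> V \<and> connected_on E (R i) \<and> 1 / 2 \<le> sum (u i) (R i)" if "i \<in> N" for i
        proof (cases "i \<in> M")
          case True
          then show ?thesis using A[OF True] CD t by (auto simp: R_def)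
        next
          case False
          then have Bi: "B i \<subseteq> V - C" "connected_on E (B i)" "1 / 2 \<le> sum (w i) (B i)"
            using B(2)[of i] that by auto
          have finB: "finite (B i)" using Bi(1) fin by (meson finite_Diff finite_subset)
          show ?thesis
          proof (cases "t \<in> B i")
            case True
            have "sum (w i) (B i) = w i t + sum (w i) (B i - {t})"
              using True finB by (intro sum.remove) auto
            also have "sum (w i) (B i - {t}) = sum (u i) (B i - {t})"
              by (intro sum.cong) (auto simp: w_def)
            also have "w i t + \<dots> = sum (u i) D + sum (u i) (B i)"
              using True finB by (subst (3) sum.remove[of _ t]) (auto simp: w_def)
            also have "\<dots> = sum (u i) (B i \<union> D)"
              using finB finite_subset[OF DC finC] Bi(1) DC by (subst sum.union_disjoint) auto
            also have "B i \<union> D = R i" using True False by (auto simp: R_def)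
            finally have "1 / 2 \<le> sum (u i) (R i)" using Bi(3) by simp
            moreover have "connected_on E (B i \<union> insert t D)"
              using Bi(2) conD True by (intro connected_on_Un) auto
            ultimately show ?thesis using True False Bi(1) DC t by (auto simp: R_def)
          next
            case t: False
            then have "sum (w i) (B i) = sum (u i) (B i)"
              by (intro sum.cong) (auto simp: w_def)
            then show ?thesis using t False Bi by (auto simp: R_def)
          qed
        qed
        ultimately show ?thesis by blast
      qed
    qed
  qed
qed

text \<open>As long as some but not all vertices are covered, an edge leaves the covered part, and
  its outer end joins the bundle of its inner end.\<close>

lemma connected_partition_extension:
  assumes sym: "sym E" and fin: "finite V" and con: "connected_on E V" and "N \<noteq> {}"
  shows "disjoint_family_on A N \<Longrightarrow> (\<And>i. i \<in> N \<Longrightarrow> A i \<subseteq> V \<and> connected_on E (A i)) \<Longrightarrow>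
    \<exists>B. disjoint_family_on B N \<and> (\<forall>i\<in>N. A i \<subseteq> B i \<and> connected_on E (B i)) \<and> (\<Union>i\<in>N. B i) = V"
proof (induction "card (V - (\<Union>i\<in>N. A i))" arbitrary: A rule: less_induct)
  case less
  define U where "U = (\<Union>i\<in>N. A i)"
  have UV: "U \<subseteq> V" using less.prems(2) by (auto simp: U_def)
  consider "U = V" | "U = {}" | "U \<noteq> V" "U \<noteq> {}" by blast
  then show ?case
  proof cases
    case 1
    then show ?thesis using less.prems by (intro exI[of _ A]) (auto simp: U_def)
  next
    case 2
    \<comment> \<open>With nothing covered there is no bundle to grow from, so one index takes all
      of \<open>V\<close>.\<close>
    obtain j where "j \<in> N" using \<open>N \<noteq> {}\<close> by blast
    then show ?thesis using 2 con
      by (intro exI[of _ "\<lambda>i. if i = j then V else {}"])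
        (auto simp: U_def disjoint_family_on_def)
  next
    case 3
    obtain x y where xy: "x \<in> U" "y \<in> V - U" "(x, y) \<in> E"
      using connected_onD[OF con UV 3(2)] 3(1) by blast
    then obtain i where i: "i \<in> N" "x \<in> A i" by (auto simp: U_def)
    define A' where "A' = A(i := insert y (A i))"
    have "connected_on E (A i \<union> {x, y})"
      using less.prems(2)[OF i(1)] i xy by (intro connected_on_Un connected_on_edge[OF sym]) auto
    moreover have "A i \<union> {x, y} = insert y (A i)" using i by auto
    ultimately have conA: "connected_on E (insert y (A i))" by simp
    have "V - (\<Union>i\<in>N. A' i) \<subset> V - (\<Union>i\<in>N. A i)"
      using xy i by (auto simp: A'_def U_def split: if_splits)
    then have "card (V - (\<Union>i\<in>N. A' i)) < card (V - (\<Union>i\<in>N. A i))"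
      using fin by (intro psubset_card_mono) auto
    moreover have "disjoint_family_on A' N"
      using less.prems(1) xy(2) unfolding A'_def U_def disjoint_family_on_def by auto
    moreover have "A' j \<subseteq> V \<and> connected_on E (A' j)" if "j \<in> N" for j
      using less.prems(2)[OF that] conA xy(2) by (auto simp: A'_def)
    ultimately obtain B where B: "disjoint_family_on B N" "\<forall>j\<in>N. A' j \<subseteq> B j \<and> connected_on E (B j)"
      "(\<Union>i\<in>N. B i) = V" using less.hyps[of A'] by blast
    moreover have "A j \<subseteq> A' j" for j by (auto simp: A'_def)
    ultimately show ?thesis by (intro exI[of _ B]) blast
  qed
qed

section \<open>Blocks and bundles\<close>

lemma graph_induce_subgraph:
  assumes "graph G" "S \<subseteq> verts G"
  shows "graph (G \<restriction> S)"
proof -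
  interpret graph G by fact
  have ind: "induced_subgraph (G \<restriction> S) G" using assms(2) by blast
  interpret H: digraph "G \<restriction> S" using ind by (rule digraphI_induced)
  show ?thesis using induced_graph_imp_symmetric[OF sym_arcs ind] by (rule H.graphI)
qed

lemma connected_on_mono:
  assumes "connected_on E S" "E \<inter> S \<times> S \<subseteq> E'"
  shows "connected_on E' S"
  using assms unfolding connected_on_def by blast

lemma arcs_ends_induce: "arcs_ends (G \<restriction> S) = arcs_ends G \<inter> S \<times> S"
  by (auto simp: arcs_ends_conv)

lemma connected_on_induce [simp]:
  assumes "T \<subseteq> S"
  shows "connected_on (arcs_ends (G \<restriction> S)) T \<longleftrightarrow> connected_on (arcs_ends G) T"
  using assms by (auto simp: arcs_ends_induce elim!: connected_on_mono)

text \<open>A closed set contains everything reachable from its members, and the set reachable from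
  a vertex is closed.\<close>

lemma reachable_iff_connected_on:
  assumes "wf_digraph H"
  shows "(\<forall>x\<in>verts H. \<forall>y\<in>verts H. x \<rightarrow>\<^sup>*\<^bsub>H\<^esub> y) \<longleftrightarrow> connected_on (arcs_ends H) (verts H)"
proof
  interpret wf_digraph H by fact
  assume R: "\<forall>x\<in>verts H. \<forall>y\<in>verts H. x \<rightarrow>\<^sup>*\<^bsub>H\<^esub> y"
  show "connected_on (arcs_ends H) (verts H)"
  proof (rule connected_onI)
    fix A assume A: "A \<subseteq> verts H" "A \<noteq> {}"
      "\<And>x y. x \<in> A \<Longrightarrow> y \<in> verts H \<Longrightarrow> x \<rightarrow>\<^bsub>H\<^esub> y \<Longrightarrow> y \<in> A"
    then obtain x where x: "x \<in> A" by blast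
    have "y \<in> A" if "x \<rightarrow>\<^sup>*\<^bsub>H\<^esub> y" for y
      using that by (induction rule: reachable_induct) (use x A adj_in_verts in blast)+
    then show "verts H \<subseteq> A" using R x A(1) by blast
  qed
next
  interpret wf_digraph H by fact
  assume con: "connected_on (arcs_ends H) (verts H)"
  show "\<forall>x\<in>verts H. \<forall>y\<in>verts H. x \<rightarrow>\<^sup>*\<^bsub>H\<^esub> y"
  proof
    fix x assume x: "x \<in> verts H"
    have "{y \<in> verts H. x \<rightarrow>\<^sup>*\<^bsub>H\<^esub> y} = verts H"
      using x by (intro connected_onD[OF con]) (auto intro: reachable_adj_trans)
    then show "\<forall>y\<in>verts H. x \<rightarrow>\<^sup>*\<^bsub>H\<^esub> y" by blast
  qed
qed

lemma connected_iff_connected_on: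
  assumes "graph H"
  shows "Digraph_Component.connected H \<longleftrightarrow> verts H \<noteq> {} \<and> connected_on (arcs_ends H) (verts H)"
proof -
  interpret graph H by fact
  show ?thesis
    unfolding Digraph_Component.connected_def strongly_connected_def
    using reachable_iff_connected_on[OF wf_digraph] reachable_mk_symmetric_eq[OF sym_arcs] by auto
qed

lemma connected_bundle_iff:
  assumes "graph G"
  shows "connected_bundle G X \<longleftrightarrow> X \<subseteq> verts G \<and> connected_on (arcs_ends G) X"
  using connected_iff_connected_on[OF graph_induce_subgraph[OF assms]]
  by (auto simp: connected_bundle_def)

text \<open>In a connected graph the reachability premise in \<open>cut_vertex\<close> always holds,
  so having no cut-vertex means that every vertex-deleted subgraph is connected.\<close>

lemma biconnected_iff:
  assumes "graph H"
  shows "biconnected H \<longleftrightarrow> verts H \<noteq> {} \<and> biconnected_on (arcs_ends H) (verts H)"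
proof -
  interpret graph H by fact
  have del: "pre_digraph.del_vert H v = H \<restriction> (verts H - {v})" for v
    by (auto simp: pre_digraph.del_vert_def induce_subgraph_def)
  have del_iff: "(\<forall>x\<in>verts H - {v}. \<forall>y\<in>verts H - {v}. x \<rightarrow>\<^sup>*\<^bsub>pre_digraph.del_vert H v\<^esub> y) \<longleftrightarrow>
      connected_on (arcs_ends H) (verts H - {v})" for v
    using reachable_iff_connected_on[OF wellformed_induce_subgraph, of "verts H - {v}"]
    by (simp add: del)
  show ?thesis
    unfolding biconnected_def biconnected_on_def connected_iff_connected_on[OF assms] cut_vertex_def
      del_iff[symmetric] reachable_iff_connected_on[OF wf_digraph, symmetric]
    using assms by blast
qed

section \<open>Hamiltonian paths in complete graphs and cycles\<close>

lemma traceable_from_complete: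
  assumes "finite S" "t \<in> S" and adj: "\<And>x y. x \<in> S \<Longrightarrow> y \<in> S \<Longrightarrow> x \<noteq> y \<Longrightarrow> (x, y) \<in> E"
  shows "traceable_from E S t"
proof -
  obtain xs where xs: "set xs = S - {t}" "distinct xs"
    using finite_distinct_list[of "S - {t}"] assms(1) by auto
  then have d: "distinct (t # xs)" and s: "set (t # xs) = S" using assms(2) by auto
  have "successively (\<lambda>x y. (x, y) \<in> E) (t # xs)"
    unfolding successively_conv_nth
  proof (intro allI impI)
    fix i assume i: "Suc i < length (t # xs)"
    then have "(t # xs) ! i \<noteq> (t # xs) ! Suc i"
      using nth_eq_iff_index_eq[OF d, of i "Suc i"] by simp
    then show "((t # xs) ! i, (t # xs) ! Suc i) \<in> E"
      using i s by (intro adj) (metis Suc_lessD nth_mem)+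
  qed
  then show ?thesis using d s unfolding traceable_from_def by blast
qed

text \<open>The edge set in \<open>cycle_graph\<close> as a function of the list alone, so that the
  list can be rotated.\<close>

definition cyclic_edges :: "'a list \<Rightarrow> ('a \<times> 'a) set" where
  "cyclic_edges vs = (\<Union>i < length vs.
     {(vs ! i, vs ! (Suc i mod length vs)), (vs ! (Suc i mod length vs), vs ! i)})"

lemma cyclic_edges_rotate: "cyclic_edges (rotate k vs) = cyclic_edges vs"
proof -
  have sub: "cyclic_edges (rotate k vs) \<subseteq> cyclic_edges vs" for k and vs :: "'a list"
  proof (cases "vs = []")
    case False
    let ?n = "length vs"
    have n: "0 < ?n" using False by simp
    have "rotate k vs ! i = vs ! ((k + i) mod ?n)"
      "rotate k vs ! (Suc i mod ?n) = vs ! (Suc ((k + i) mod ?n) mod ?n)" if "i < ?n" for i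
      using that n by (simp_all add: nth_rotate mod_simps)
    moreover have "(k + i) mod ?n < ?n" for i using n by simp
    ultimately show ?thesis unfolding cyclic_edges_def by fastforce
  qed (simp add: cyclic_edges_def)
  \<comment> \<open>The two rotations add up to a multiple of the length, so the second undoes the
    first and one inclusion suffices.\<close>
  have "cyclic_edges vs = cyclic_edges (rotate (length vs * k - k) (rotate k vs))"
  proof (cases "vs = []")
    case False
    then have "length vs * k - k + k = length vs * k" by (cases "length vs") auto
    then have "rotate (length vs * k - k) (rotate k vs) = vs"
      by (simp add: rotate_rotate rotate_id)
    then show ?thesis by simp
  qed simp
  then show ?thesis using sub[of k vs] sub[of "length vs * k - k" "rotate k vs"] by blast
qed

text \<open>Rotating the list moves \<open>t\<close> to the front; dropping the wrap-around edge
  leaves a path.\<close>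

lemma traceable_from_cycle:
  assumes "distinct vs" "t \<in> set vs" "cyclic_edges vs \<subseteq> E"
  shows "traceable_from E (set vs) t"
proof -
  obtain k where k: "k < length vs" "vs ! k = t" using assms(2) by (auto simp: in_set_conv_nth)
  define ws where "ws = rotate k vs"
  have ws: "length ws = length vs" "distinct ws" "set ws = set vs" "cyclic_edges ws \<subseteq> E"
    using assms by (auto simp: ws_def cyclic_edges_rotate)
  have "vs \<noteq> []" using k(1) by auto
  then have "ws ! 0 = t" "ws \<noteq> []" using k nth_rotate[of 0 vs k] by (simp_all add: ws_def)
  then obtain xs where xs: "ws = t # xs" by (metis nth_Cons_0 neq_Nil_conv)
  have "successively (\<lambda>x y. (x, y) \<in> E) ws"
    unfolding successively_conv_nth
  proof (intro allI impI)
    fix i assume i: "Suc i < length ws"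
    then have "(ws ! i, ws ! (Suc i mod length ws)) \<in> cyclic_edges ws"
      by (auto simp: cyclic_edges_def)
    then show "(ws ! i, ws ! Suc i) \<in> E" using i ws(4) by auto
  qed
  then show ?thesis using ws xs unfolding traceable_from_def by metis
qed

text \<open>Rotating a missing vertex to the end places \<open>S\<close> on a path. Two
  non-consecutive members of \<open>S\<close> would be separated by deleting a position between
  them, so all pairs in \<open>S\<close> are consecutive.\<close>

lemma biconnected_on_proper_subset_of_cycle:
  assumes "distinct vs" and E: "E \<inter> set vs \<times> set vs = cyclic_edges vs"
    and S: "S \<subset> set vs" "biconnected_on E S" and xy: "x \<in> S" "y \<in> S" "x \<noteq> y"
  shows "(x, y) \<in> E"
proof -
  let ?n = "length vs"
  obtain z where "z \<in> set vs" "z \<notin> S" using S(1) by blast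
  then obtain k where k: "k < ?n" "vs ! k \<notin> S" by (auto simp: in_set_conv_nth)
  \<comment> \<open>Rotation by one more than \<open>k\<close> puts the missing vertex last rather
    than first.\<close>
  define k' where "k' = Suc k"
  define ws where "ws = rotate k' vs"
  have ws: "length ws = ?n" "distinct ws" "set ws = set vs"
    and Ews: "E \<inter> set ws \<times> set ws = cyclic_edges ws"
    using assms(1) E by (simp_all add: ws_def cyclic_edges_rotate)
  have "k' + (?n - 1) = k + ?n" using k by (simp add: k'_def)
  then have last: "ws ! (?n - 1) \<notin> S"
    using k nth_rotate[of "?n - 1" vs k'] by (simp add: ws_def)
  have idx: "\<exists>l. Suc l < ?n \<and> ws ! l = s" if "s \<in> S" for s
  proof -
    have "s \<in> set ws" using that S(1) ws(3) by blast
    then obtain l where "l < ?n" "ws ! l = s" by (auto simp: in_set_conv_nth ws(1))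
    moreover have "l \<noteq> ?n - 1" using last that \<open>ws ! l = s\<close> by auto
    ultimately show ?thesis by (intro exI[of _ l]) auto
  qed
  have consec: "j = Suc i"
    if ij: "i < j" "Suc j < ?n" "ws ! i \<in> S" "ws ! j \<in> S" for i j
  proof (rule ccontr)
    assume neq: "j \<noteq> Suc i"
    \<comment> \<open>If the vertex after position \<open>i\<close> is not in \<open>S\<close>, then
      \<open>T\<close> is \<open>S\<close> itself; either way \<open>T\<close> is connected.\<close>
    define T where "T = S - {ws ! Suc i}"
    define A where "A = {ws ! l |l. l \<le> i} \<inter> S"
    have conT: "connected_on E T"
      using S(2) unfolding biconnected_on_def T_def by (cases "ws ! Suc i \<in> S") auto
    have A_iff: "ws ! l \<in> A \<longleftrightarrow> l \<le> i \<and> ws ! l \<in> S" if "l < ?n" for l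
      using that ij ws(1,2) by (auto simp: A_def nth_eq_iff_index_eq)
    have "A = T"
    proof (rule connected_onD[OF conT])
      show "A \<subseteq> T" using ij ws(1,2) by (auto simp: A_def T_def nth_eq_iff_index_eq)
      show "A \<noteq> {}" using ij by (auto simp: A_def)
    next
      fix p q assume p: "p \<in> A" and q: "q \<in> T" and pq: "(p, q) \<in> E"
      have pS: "p \<in> S" and qS: "q \<in> S" using p q by (auto simp: A_def T_def)
      obtain l where l: "Suc l < ?n" "p = ws ! l" using idx[OF pS] by auto
      obtain l' where l': "Suc l' < ?n" "q = ws ! l'" using idx[OF qS] by auto
      have "l \<le> i" using A_iff[of l] p l by simp
      have "l' \<noteq> Suc i" using q l' by (auto simp: T_def)
      have "(p, q) \<in> cyclic_edges ws" using pq pS qS S(1) Ews ws(3) by blast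
      then obtain m where m: "m < ?n"
        "p = ws ! m \<and> q = ws ! (Suc m mod ?n) \<or> p = ws ! (Suc m mod ?n) \<and> q = ws ! m"
        unfolding cyclic_edges_def ws(1) by blast
      have mn: "Suc m mod ?n < ?n" using m(1) by (intro mod_less_divisor) linarith
      have inj: "a = b" if "ws ! a = ws ! b" "a < ?n" "b < ?n" for a b
        using that ws(1,2) by (simp add: nth_eq_iff_index_eq)
      \<comment> \<open>An edge inside \<open>S\<close> advances by at most one position, as the
        wrap-around edge would need the last vertex.\<close>
      have "l' \<le> Suc l"
        using m(2)
      proof
        assume "p = ws ! m \<and> q = ws ! (Suc m mod ?n)"
        then have "m = l" "l' = Suc m mod ?n" using inj m(1) mn l l' by auto
        then show ?thesis using l by simp
      next
        assume "p = ws ! (Suc m mod ?n) \<and> q = ws ! m"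
        then have "m = l'" "l = Suc m mod ?n" using inj m(1) mn l l' by auto
        then show ?thesis using l' by simp
      qed
      then have "l' \<le> i" using \<open>l \<le> i\<close> \<open>l' \<noteq> Suc i\<close> by simp
      then show "q \<in> A" using A_iff[of l'] qS l' by simp
    qed
    moreover have "ws ! j \<in> T" using ij neq ws(1,2) by (auto simp: T_def nth_eq_iff_index_eq)
    moreover have "ws ! j \<notin> A" using A_iff[of j] ij by simp
    ultimately show False by simp
  qed
  have edge: "(ws ! i, ws ! Suc i) \<in> E" "(ws ! Suc i, ws ! i) \<in> E" if "Suc i < ?n" for i
  proof -
    have "{(ws ! i, ws ! (Suc i mod ?n)), (ws ! (Suc i mod ?n), ws ! i)} \<subseteq> cyclic_edges ws"
      using that unfolding cyclic_edges_def ws(1) by (intro UN_upper) simp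
    then show "(ws ! i, ws ! Suc i) \<in> E" "(ws ! Suc i, ws ! i) \<in> E"
      using that Ews by auto
  qed
  obtain i j where ij: "Suc i < ?n" "x = ws ! i" "Suc j < ?n" "y = ws ! j"
    using idx xy by metis
  then have "i < j \<or> j < i" using xy(3) by (metis linorder_neqE_nat)
  then show ?thesis
    using consec[of i j] consec[of j i] edge ij xy by auto
qed

section \<open>Biconnected vertex sets inside blocks\<close>

lemma biconnected_on_mono:
  assumes "biconnected_on E S" "E \<subseteq> E'"
  shows "biconnected_on E' S"
  using assms connected_on_mono unfolding biconnected_on_def by (metis inf.coboundedI1)

lemma biconnected_on_induce:
  "biconnected_on (arcs_ends (G \<restriction> S)) S \<longleftrightarrow> biconnected_on (arcs_ends G) S"
  by (simp add: biconnected_on_def)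

text \<open>A maximal biconnected vertex set \<open>B\<close> above \<open>S\<close> induces a
  block: the vertices of a biconnected subgraph stay biconnected with all edges of \<open>G\<close>,
  so a larger competitor has the same vertices, and the induced subgraph already has all arcs
  between them.\<close>

lemma block_above:
  assumes G: "graph G" and S: "S \<subseteq> verts G" "S \<noteq> {}" "biconnected_on (arcs_ends G) S"
  obtains B where "S \<subseteq> B" "B \<subseteq> verts G" "block G (G \<restriction> B)"
proof -
  interpret graph G by fact
  let ?P = "\<lambda>B. S \<subseteq> B \<and> B \<subseteq> verts G \<and> biconnected_on (arcs_ends G) B"
  have "finite {B. ?P B}" by (rule finite_subset[of _ "Pow (verts G)"]) auto
  moreover have "S \<in> {B. ?P B}" using S by simp
  ultimately obtain B where B: "?P B" and max: "\<And>B'. ?P B' \<Longrightarrow> B \<subseteq> B' \<Longrightarrow> B = B'"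
    using finite_has_maximal2[of "{B. ?P B}" S] by (metis (no_types, lifting) mem_Collect_eq)
  have sub: "subgraph (G \<restriction> B) G" using B by (intro induced_imp_subgraph induced_induce) auto
  have "biconnected (G \<restriction> B)"
    using biconnected_iff[OF graph_induce_subgraph[OF G]] B S(2)
    by (auto simp: biconnected_on_induce)
  moreover have "H = G \<restriction> B" if H: "subgraph (G \<restriction> B) H" "subgraph H G" "biconnected H" for H
  proof -
    have "graph H" using H(3) by (simp add: biconnected_def)
    have "arcs_ends H \<subseteq> arcs_ends G"
      using H(2) by (auto simp: subgraph_def compatible_def arcs_ends_conv)
    then have "biconnected_on (arcs_ends G) (verts H)"
      using biconnected_iff[OF \<open>graph H\<close>] H(3) biconnected_on_mono by blast
    moreover have "B \<subseteq> verts H" "verts H \<subseteq> verts G"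
      using H by (auto simp: subgraph_def)
    ultimately have vH: "verts H = B" using max[of "verts H"] B by blast
    have "arcs H \<subseteq> arcs (G \<restriction> B)"
      using H(2) vH unfolding subgraph_def compatible_def
      by (auto dest: wf_digraph.tail_in_verts wf_digraph.head_in_verts)
    then have "arcs H = arcs (G \<restriction> B)" using H(1) by (auto simp: subgraph_def)
    then show ?thesis
      using vH H(1) by (intro pre_digraph.equality) (auto simp: subgraph_def compatible_def)
  qed
  ultimately have "block G (G \<restriction> B)"
    using sub unfolding block_def pre_digraph.max_subgraph_def by blast
  then show thesis using B that by blast
qed

text \<open>\<open>S\<close> lies in a block. In a complete block it is a clique; in a cycle it is
  either the whole cycle or again a clique.\<close>

lemma block_cactus_traceable:
  assumes "block_cactus G" "S \<subseteq> verts G" "biconnected_on (arcs_ends G) S" "t \<in> S"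
  shows "traceable_from (arcs_ends G) S t"
proof -
  have G: "graph G" using assms(1) by (simp add: block_cactus_def)
  interpret graph G by fact
  have finS: "finite S" using assms(2) finite_verts by (rule finite_subset)
  obtain B where B: "S \<subseteq> B" "B \<subseteq> verts G" "block G (G \<restriction> B)"
    using block_above[OF G assms(2) _ assms(3)] assms(4) by blast
  then consider "cycle_graph (G \<restriction> B)" | "complete_graph (G \<restriction> B)"
    using assms(1) by (auto simp: block_cactus_def)
  then show ?thesis
  proof cases
    case 1
    then obtain vs where vs: "distinct vs" "B = set vs"
      "arcs_ends G \<inter> set vs \<times> set vs = cyclic_edges vs"
      unfolding cycle_graph_def arcs_ends_induce cyclic_edges_def by auto
    show ?thesis
    proof (cases "S = B")
      case True
      then show ?thesis using traceable_from_cycle[OF vs(1)] vs(2,3) assms(4) by blast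
    next
      case False
      then have "S \<subset> set vs" using B(1) vs(2) by blast
      then show ?thesis
        using biconnected_on_proper_subset_of_cycle[OF vs(1,3) _ assms(3)]
        by (intro traceable_from_complete[OF finS assms(4)]) blast
    qed
  next
    case 2
    then have "arcs_ends G \<inter> B \<times> B = {(x, y). (x, y) \<in> B \<times> B \<and> x \<noteq> y}"
      by (auto simp: complete_graph_def complete_digraph_def arcs_ends_induce)
    then show ?thesis
      using B(1) by (intro traceable_from_complete[OF finS assms(4)]) blast
  qed
qed

section \<open>From maximin shares to packings and the final allocation\<close>

lemma mms_attained:
  assumes "graph G" "Digraph_Component.connected G" "n \<ge> 1"
  obtains P where "graph_partition G n P" "\<And>j. j \<in> {1..n} \<Longrightarrow> mms n G w \<le> sum w (P j)"
proof -
  have "mms n G w \<in> {Min ((\<lambda>j. sum w (P j)) ` {1..n}) | P. graph_partition G n P}"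
    unfolding mms_def using finite_mms_values mms_values_nonempty assms by (intro Max_in) blast+
  then obtain P where "graph_partition G n P" "mms n G w = Min ((\<lambda>j. sum w (P j)) ` {1..n})"
    by blast
  then show thesis by (intro that[of P]) auto
qed

text \<open>An optimal partition serves as the packing. A positive share makes its parts nonempty,
  so they are distinct and there are \<open>n\<close> of them.\<close>

lemma packing_mms:
  assumes "graph G" "Digraph_Component.connected G" "n \<ge> 1" "0 < mms n G w"
  shows "packing (arcs_ends G) (verts G) (\<lambda>v. w v / mms n G w) n"
proof -
  obtain P where P: "graph_partition G n P" and le: "\<And>j. j \<in> {1..n} \<Longrightarrow> mms n G w \<le> sum w (P j)"
    using mms_attained[OF assms(1-3)] by blast
  have ne: "P j \<noteq> {}" if "j \<in> {1..n}" for j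
    using le[OF that] assms(4) by auto
  have disj: "P i \<inter> P j = {}" if "i \<in> {1..n}" "j \<in> {1..n}" "i \<noteq> j" for i j
    using P that by (auto simp: graph_partition_def disjoint_family_on_def)
  have "inj_on P {1..n}" using ne disj by (metis inf.idem inj_onI)
  then have "card (P ` {1..n}) = n" by (simp add: card_image)
  moreover have "disjoint (P ` {1..n})"
    unfolding disjoint_def using disj by (metis (no_types, lifting) imageE)
  moreover have "P j \<subseteq> verts G \<and> connected_on (arcs_ends G) (P j) \<and> 1 \<le> (\<Sum>v\<in>P j. w v / mms n G w)"
    if "j \<in> {1..n}" for j
    using P le[OF that] that assms(4) connected_bundle_iff[OF assms(1)]
    by (auto simp: graph_partition_def sum_divide_distrib[symmetric])
  ultimately show ?thesis
    unfolding packing_def by (intro exI[of _ "P ` {1..n}"]) auto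
qed

theorem theorem2:
  fixes G :: "('a, 'b) pre_digraph" and n :: nat and u :: "nat \<Rightarrow> 'a \<Rightarrow> real"
  assumes "graph G"
    and "Digraph_Component.connected G"
    and "block_cactus G"
    and "n \<ge> 1"
    and "\<And>i v. i \<in> {1..n} \<Longrightarrow> v \<in> verts G \<Longrightarrow> u i v \<ge> 0"
  shows "\<exists>A. graph_partition G n A \<and>
    (\<forall>i \<in> {1..n}. sum (u i) (A i) \<ge> 1 / 2 * mms n G (u i))"
proof -
  interpret graph G by fact
  let ?E = "arcs_ends G" and ?V = "verts G"
  \<comment> \<open>Only agents with a positive share can be scaled; any bundle satisfies the
    others.\<close>
  define N where "N = {i \<in> {1..n}. 0 < mms n G (u i)}"
  define w where "w i v = u i v / mms n G (u i)" for i v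
  have sym: "sym ?E" using sym_arcs by (simp add: symmetric_def)
  have con: "connected_on ?E ?V" using assms(1,2) connected_iff_connected_on by blast
  have "card N \<le> card {1..n}" by (intro card_mono) (auto simp: N_def)
  then have cardN: "card N \<le> n" by simp
  have "\<exists>A. disjoint_family_on A N \<and>
      (\<forall>i\<in>N. A i \<subseteq> ?V \<and> connected_on ?E (A i) \<and> 1 / 2 \<le> sum (w i) (A i))"
  proof (rule half_allocation_exists[OF sym finite_verts con])
    show "traceable_from ?E S t" if "S \<subseteq> ?V" "biconnected_on ?E S" "t \<in> S" for S t
      using block_cactus_traceable[OF assms(3)] that by blast
    show "finite N" by (simp add: N_def)
    show "0 \<le> w i v" if "i \<in> N" "v \<in> ?V" for i v
      using that assms(5) by (simp add: N_def w_def)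
    show "packing ?E ?V (w i) (card N)" if "i \<in> N" for i
      using packing_antimono[OF packing_mms[OF assms(1,2,4)] cardN, of "u i"] that
      by (simp add: N_def w_def[abs_def])
  qed
  then obtain A where A: "disjoint_family_on A N"
    "\<And>i. i \<in> N \<Longrightarrow> A i \<subseteq> ?V \<and> connected_on ?E (A i) \<and> 1 / 2 \<le> sum (w i) (A i)" by blast
  define A' where "A' i = (if i \<in> N then A i else {})" for i
  \<comment> \<open>Agents outside \<open>N\<close> start with the empty bundle; enlarging bundles
    loses no value because utilities are nonnegative.\<close>
  have "\<exists>B. disjoint_family_on B {1..n} \<and>
      (\<forall>i\<in>{1..n}. A' i \<subseteq> B i \<and> connected_on ?E (B i)) \<and> (\<Union>i\<in>{1..n}. B i) = ?V"
    using A assms(4)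
    by (intro connected_partition_extension[OF sym finite_verts con])
      (auto simp: A'_def disjoint_family_on_def)
  then obtain B where B: "disjoint_family_on B {1..n}" "(\<Union>i\<in>{1..n}. B i) = ?V"
    "\<And>i. i \<in> {1..n} \<Longrightarrow> A' i \<subseteq> B i \<and> connected_on ?E (B i)" by blast
  have BV: "B i \<subseteq> ?V" if "i \<in> {1..n}" for i using B(2) that by blast
  have "graph_partition G n B"
    using B BV by (auto simp: graph_partition_def connected_bundle_iff[OF assms(1)])
  moreover have "1 / 2 * mms n G (u i) \<le> sum (u i) (B i)" if i: "i \<in> {1..n}" for i
  proof (cases "i \<in> N")
    case True
    have "1 / 2 \<le> sum (u i) (A i) / mms n G (u i)"
      using A(2)[OF True] by (simp add: w_def sum_divide_distrib)
    then have "1 / 2 * mms n G (u i) \<le> sum (u i) (A i)"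
      using True by (simp add: N_def field_simps)
    also have "\<dots> \<le> sum (u i) (B i)"
      using B(3)[OF i] BV[OF i] True assms(5)[OF i] finite_subset[OF _ finite_verts]
      by (intro sum_mono2) (auto simp: A'_def)
    finally show ?thesis .
  next
    case False
    then have "1 / 2 * mms n G (u i) \<le> 0" using i by (simp add: N_def)
    also have "0 \<le> sum (u i) (B i)" using BV[OF i] assms(5)[OF i] by (intro sum_nonneg) auto
    finally show ?thesis .
  qed
  ultimately show ?thesis by blast
qed

end
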